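(* Let $\{f(x;\theta):\theta\in\Theta\}$, $\Theta\subset\mathbb{R}$, be a family of probability densities on $\mathbb{R}$ such that $m(\theta)=\int_{-\infty}^{\infty}x f(x;\theta)\,dx$ is finite and continuous on $\Theta$, $f(x;\theta)$ is $TP_2$ in $(x,\theta)$, and for each $\theta$ the function $x\mapsto f(x;\theta)$ is logconcave. Then the moment estimator $\hat\theta=m^{-1}(\bar X)$ is increasing in $\theta$ with respect to the likelihood ratio order: if $\theta_1<\theta_2$ in $\Theta$ and $\hat\theta_1,\hat\theta_2$ are the moment estimators computed from i.i.d. samples of size $n$ from $f(\cdot;\theta_1)$ and $f(\cdot;\theta_2)$ respectively, then $\hat\theta_1\le_{\mathrm{lr}}\hat\theta_2$.
   Context: Moment estimator: for a sample $X_1,\dots,X_n$ i.i.d. with density $f(\cdot;\theta)$ and a function $g$ with $m(\theta)=\int g(x)f(x;\theta)\,dx$ monotone and continuous on $\Theta$, set $\bar g=\frac1n\sum_{i=1}^n g(X_i)$; it is assumed that $\bar g\in m(\Theta)$ for every possible sample, and the moment estimator is $\hat\theta=m^{-1}(\bar g)$, where $m^{-1}$ is the inverse of $m$ (a generalized monotone inverse if $m$ is only weakly monotone). Here $g(x)=x$, so $\bar g=\bar X$. A function $k(x,y)$ is $TP_2$ if $k\ge 0$ and $k(x_1,y_1)k(x_2,y_2)-k(x_1,y_2)k(x_2,y_1)\ge 0$ whenever $x_1<x_2$, $y_1<y_2$. For random variables $X,Y$ with densities $f_X,f_Y$, $X\le_{\mathrm{lr}}Y$ means $f_Y(x)/f_X(x)$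 is increasing in $x$. A function $h\ge0$ is logconcave if $\log h$ is concave (with $\log 0=-\infty$). *)

theory Defs
  imports "HOL-Probability.Probability"
begin

definition TP2_on :: "'a::linorder set \<Rightarrow> 'b::linorder set \<Rightarrow> ('a \<Rightarrow> 'b \<Rightarrow> real) \<Rightarrow> bool" where
  "TP2_on A B k \<longleftrightarrow>
     (\<forall>x\<in>A. \<forall>y\<in>B. 0 \<le> k x y) \<and>
     (\<forall>x1\<in>A. \<forall>x2\<in>A. \<forall>y1\<in>B. \<forall>y2\<in>B. x1 < x2 \<longrightarrow> y1 < y2 \<longrightarrow>
        k x1 y2 * k x2 y1 \<le> k x1 y1 * k x2 y2)"

definition elog :: "real \<Rightarrow> ereal" where
  "elog t = (if t = 0 then -\<infinity> else ereal (ln t))"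

definition logconcave :: "(real \<Rightarrow> real) \<Rightarrow> bool" where
  "logconcave h \<longleftrightarrow> (\<forall>x. 0 \<le> h x) \<and>
     (\<forall>x y t. 0 \<le> t \<and> t \<le> 1 \<longrightarrow>
        ereal t * elog (h x) + ereal (1 - t) * elog (h y) \<le> elog (h (t * x + (1 - t) * y)))"

text \<open>Likelihood ratio order between two probability distributions on the reals:
  both have densities p, q with respect to a common sigma-finite dominating measure
  and q/p is increasing, i.e. p v * q u <= p u * q v for u <= v.\<close>
definition lr_le :: "real measure \<Rightarrow> real measure \<Rightarrow> bool" where
  "lr_le P Q \<longleftrightarrow>
     (\<exists>\<mu> p q. sigma_finite_measure \<mu> \<and> sets \<mu> = sets borel \<and>
        p \<in> borel_measurable borel \<and> q \<in> borel_measurable borel \<and>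
        (\<forall>x. 0 \<le> p x \<and> 0 \<le> q x) \<and>
        P = density \<mu> (\<lambda>x. ennreal (p x)) \<and> Q = density \<mu> (\<lambda>x. ennreal (q x)) \<and>
        (\<forall>u v. u \<le> v \<longrightarrow> p v * q u \<le> p u * q v))"

definition sample_law :: "(real \<Rightarrow> real \<Rightarrow> real) \<Rightarrow> nat \<Rightarrow> real \<Rightarrow> (nat \<Rightarrow> real) measure" where
  "sample_law f n \<theta> = PiM {..<n} (\<lambda>_. density lborel (\<lambda>x. ennreal (f x \<theta>)))"

definition sample_mean :: "nat \<Rightarrow> (nat \<Rightarrow> real) \<Rightarrow> real" where
  "sample_mean n xs = (\<Sum>i<n. xs i) / real n"

end

theory Submission
  imports Defs
begin

text \<open>
  For logconcave \<open>g\<close> the kernel \<open>g (x - y)\<close> is totally positive of order two, so by the basic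
  composition formula convolution with \<open>g\<close> preserves the likelihood ratio order. Applied to a
  density and its translates, this also shows that logconcavity survives convolution. Replacing
  the summands one at a time, from the first family member to the second, orders the laws of the
  sample sum. The order is then transported along the inverse of the mean function, which is
  strictly increasing on its range.
\<close>

section \<open>Likelihood ratio monotonicity, PF2 functions and logconcavity\<close>

definition lr_mono :: "(real \<Rightarrow> real) \<Rightarrow> (real \<Rightarrow> real) \<Rightarrow> bool" where
  "lr_mono p q \<longleftrightarrow> (\<forall>u v. u \<le> v \<longrightarrow> p v * q u \<le> p u * q v)"

text \<open>A Polya frequency condition of order two. With \<open>x1 = u + y1\<close>,
  \<open>x2 = v + y1\<close> and \<open>y2 = y1 + s\<close> it is the minor inequality for the
  kernel \<open>g (x - y)\<close>; stated through translates, it can be fed directly to results on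
  \<open>lr_mono\<close>.\<close>

definition PF2 :: "(real \<Rightarrow> real) \<Rightarrow> bool" where
  "PF2 g \<longleftrightarrow> (\<forall>s\<ge>0. lr_mono g (\<lambda>x. g (x - s)))"

definition pdf :: "(real \<Rightarrow> real) \<Rightarrow> bool" where
  "pdf g \<longleftrightarrow> (\<forall>x. 0 \<le> g x) \<and> g \<in> borel_measurable borel \<and> (\<integral>\<^sup>+x. ennreal (g x) \<partial>lborel) = 1"

text \<open>\<open>enn2real\<close> sends an infinite integral to 0, so the value is the true
  convolution only where that integral is finite.\<close>

definition fconv :: "(real \<Rightarrow> real) \<Rightarrow> (real \<Rightarrow> real) \<Rightarrow> real \<Rightarrow> real" where
  "fconv a b x = enn2real (\<integral>\<^sup>+y. ennreal (a (x - y) * b y) \<partial>lborel)"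

lemma lr_monoD: "lr_mono p q \<Longrightarrow> u \<le> v \<Longrightarrow> p v * q u \<le> p u * q v"
  by (simp add: lr_mono_def)

lemma pdf_nonneg: "pdf g \<Longrightarrow> 0 \<le> g x"
  by (simp add: pdf_def)

lemma pdf_measurable: "pdf g \<Longrightarrow> g \<in> borel_measurable borel"
  by (simp add: pdf_def)

lemma pdf_nn_integral: "pdf g \<Longrightarrow> (\<integral>\<^sup>+x. ennreal (g x) \<partial>lborel) = 1"
  by (simp add: pdf_def)

text \<open>A single point is Lebesgue null, so a function supported there cannot integrate to
  1.\<close>

lemma pdf_two_points:
  assumes g: "pdf g"
  obtains a b where "a < b" "0 < g a" "0 < g b"
proof -
  have "\<exists>a b. a < b \<and> 0 < g a \<and> 0 < g b"
  proof (rule ccontr)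
    assume no: "\<not> ?thesis"
    have "x = y" if "g x \<noteq> 0" "g y \<noteq> 0" for x y
    proof -
      have "0 < g x" "0 < g y"
        using that pdf_nonneg[OF g, of x] pdf_nonneg[OF g, of y] by simp_all
      then show ?thesis using no by (cases x y rule: linorder_cases) blast+
    qed
    then obtain a where a: "\<And>x. x \<noteq> a \<Longrightarrow> g x = 0" by blast
    have "AE x in lborel. ennreal (g x) = 0"
      using AE_lborel_singleton[of a] by eventually_elim (simp add: a)
    then have "(\<integral>\<^sup>+x. ennreal (g x) \<partial>lborel) = (\<integral>\<^sup>+(x::real). 0 \<partial>lborel)"
      by (rule nn_integral_cong_AE)
    then show False using pdf_nn_integral[OF g] by simp
  qed
  then show ?thesis using that by blast
qed

text \<open>The cross-multiplied relation is not transitive in general: a vanishing \<open>q\<close>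
  is related to everything. One point \<open>w\<close> with \<open>0 < q w\<close> repairs this.
  Where \<open>q\<close> is positive at \<open>u\<close> and \<open>v\<close> the two inequalities
  multiply and cancel; otherwise the left side is zero.\<close>

lemma lr_mono_trans:
  assumes pq: "lr_mono p q" and qr: "lr_mono q r"
    and nn: "\<And>x. 0 \<le> p x" "\<And>x. 0 \<le> q x" "\<And>x. 0 \<le> r x" and w: "0 < q w"
  shows "lr_mono p r"
  unfolding lr_mono_def
proof (intro allI impI)
  fix u v :: real assume uv: "u \<le> v"
  have rhs: "0 \<le> p u * r v" by (simp add: nn)
  have 1: "p v * q u \<le> p u * q v" and 2: "q v * r u \<le> q u * r v"
    using lr_monoD[OF pq uv] lr_monoD[OF qr uv] by auto
  show "p v * r u \<le> p u * r v"
  proof (cases "0 < q u \<and> 0 < q v")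
    case True
    have "(p v * q u) * (q v * r u) \<le> (p u * q v) * (q u * r v)"
      by (rule mult_mono[OF 1 2]) (simp_all add: nn)
    then have "(q u * q v) * (p v * r u) \<le> (q u * q v) * (p u * r v)"
      by (simp add: mult_ac)
    then show ?thesis using True by (simp add: mult_le_cancel_left_pos)
  next
    case False
    have "p v = 0 \<or> r u = 0"
    proof (rule ccontr)
      assume "\<not> ?thesis"
      then have pv: "0 < p v" and ru: "0 < r u" using nn by (auto simp: order_le_less)
      have "q u = 0 \<or> q v = 0" using False nn(2)[of u] nn(2)[of v] by auto
      \<comment> \<open>Facts \<open>1\<close> and \<open>2\<close> each carry a zero of
        \<open>q\<close> from one of the two points to the other.\<close>
      then have "q u = 0" "q v = 0"
        using 1 2 pv ru nn(2)[of u] nn(2)[of v] by (auto simp: mult_le_0_iff)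
      \<comment> \<open>If \<open>w \<le> v\<close>, comparing \<open>w\<close> with
        \<open>v\<close> makes \<open>p v * q w\<close> vanish; otherwise \<open>u \<le> w\<close>
        and \<open>q w * r u\<close> vanishes. Both products are positive.\<close>
      moreover have "p v * q w \<le> p w * q v" if "w \<le> v" using lr_monoD[OF pq that] .
      moreover have "q w * r u \<le> q u * r w" if "u \<le> w" using lr_monoD[OF qr that] .
      ultimately show False
        using w pv ru uv mult_pos_pos[OF pv w] mult_pos_pos[OF w ru] by (cases "w \<le> v") auto
    qed
    then show ?thesis using rhs by auto
  qed
qed

text \<open>The points \<open>u\<close> and \<open>v - s\<close> lie between \<open>u - s\<close>
  and \<open>v\<close> and have the same sum as these, so they are convex combinations with
  exchanged weights. Adding the two concavity inequalities gives the claim.\<close>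

lemma logconcave_imp_PF2:
  assumes g: "logconcave g"
  shows "PF2 g"
  unfolding PF2_def lr_mono_def
proof (intro allI impI)
  fix s u v :: real assume s: "0 \<le> s" and uv: "u \<le> v"
  have nn: "\<And>x. 0 \<le> g x" using g by (simp add: logconcave_def)
  have key: "0 < g (t * x + (1 - t) * y) \<and> t * ln (g x) + (1 - t) * ln (g y) \<le> ln (g (t * x + (1 - t) * y))"
    if "0 \<le> t" "t \<le> 1" "0 < g x" "0 < g y" for t x y
  proof -
    have "ereal t * elog (g x) + ereal (1 - t) * elog (g y) \<le> elog (g (t * x + (1 - t) * y))"
      using g that by (simp add: logconcave_def)
    with that nn[of "t * x + (1 - t) * y"] show ?thesis
      by (auto simp: elog_def split: if_splits)
  qed
  show "g v * g (u - s) \<le> g u * g (v - s)"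
  proof (cases "g v = 0 \<or> g (u - s) = 0 \<or> v = u - s")
    case True
    then show ?thesis using nn s uv by auto
  next
    case False
    \<comment> \<open>The weight solving \<open>t * v + (1 - t) * (u - s) = u\<close>; the excluded
      case \<open>v = u - s\<close> is the one with zero denominator.\<close>
    define t where "t = s / (v - u + s)"
    have d: "0 < v - u + s" using False s uv by linarith
    have t: "0 \<le> t" "t \<le> 1" using s uv d by (auto simp: t_def)
    have td: "t * (v - u + s) = s" using d by (simp add: t_def)
    have pos: "0 < g v" "0 < g (u - s)" using False nn by (auto simp: order_le_less)
    have e1: "t * v + (1 - t) * (u - s) = u" using td by (simp add: algebra_simps)
    have e2: "t * (u - s) + (1 - t) * v = v - s" using td by (simp add: algebra_simps)
    have 1: "0 < g u" "t * ln (g v) + (1 - t) * ln (g (u - s)) \<le> ln (g u)"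
      using key[OF t pos] unfolding e1 by auto
    have 2: "0 < g (v - s)" "t * ln (g (u - s)) + (1 - t) * ln (g v) \<le> ln (g (v - s))"
      using key[OF t pos(2,1)] unfolding e2 by auto
    have "ln (g v) + ln (g (u - s)) \<le> ln (g u) + ln (g (v - s))"
      using 1(2) 2(2) by (simp add: algebra_simps)
    then have "ln (g v * g (u - s)) \<le> ln (g u * g (v - s))"
      using pos 1 2 by (simp add: ln_mult)
    then show ?thesis using pos 1 2 by simp
  qed
qed

section \<open>Boundedness of PF2 densities\<close>

lemma nn_integral_reflect:
  fixes f :: "real \<Rightarrow> ennreal"
  assumes [measurable]: "f \<in> borel_measurable borel"
  shows "(\<integral>\<^sup>+y. f (c - y) \<partial>lborel) = (\<integral>\<^sup>+y. f y \<partial>lborel)"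
  using nn_integral_real_affine[of f "-1" c] by simp

lemma nn_integral_translate:
  fixes f :: "real \<Rightarrow> ennreal"
  assumes [measurable]: "f \<in> borel_measurable borel"
  shows "(\<integral>\<^sup>+y. f (y - c) \<partial>lborel) = (\<integral>\<^sup>+y. f y \<partial>lborel)"
  using nn_integral_real_affine[of f 1 "-c"] by simp

text \<open>Between \<open>a\<close> and \<open>b\<close>, PF2 gives
  \<open>g a * g b \<le> g y * g (a + b - y)\<close>. The arithmetic-geometric mean inequality
  bounds the root of the right side by the average of \<open>g\<close> at \<open>y\<close> and at
  its reflection, and both terms integrate to 1.\<close>

lemma PF2_pdf_product_bound:
  assumes g: "pdf g" and P: "PF2 g" and ab: "a \<le> b"
  shows "(b - a) * sqrt (g a * g b) \<le> 1"
proof -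
  note [measurable] = pdf_measurable[OF g]
  note nn = pdf_nonneg[OF g]
  define c where "c = sqrt (g a * g b)"
  have c0: "0 \<le> c" by (simp add: c_def nn)
  have pt: "2 * c * indicator {a..b} y \<le> g y + g (a + b - y)" for y
  proof (cases "y \<in> {a..b}")
    case True
    then have "g b * g (y - (y - a)) \<le> g y * g (b - (y - a))"
      using P lr_monoD[of g "\<lambda>x. g (x - (y - a))" y b] by (auto simp: PF2_def)
    then have "g a * g b \<le> g y * g (a + b - y)" by (simp add: mult.commute algebra_simps)
    then have "c \<le> sqrt (g y * g (a + b - y))" by (simp add: c_def)
    also have "\<dots> \<le> (g y + g (a + b - y)) / 2"
      using arith_geo_mean_sqrt[OF nn nn] .
    finally show ?thesis using True by simp
  qed (simp add: nn)
  have "ennreal (2 * c * (b - a)) = (\<integral>\<^sup>+y. ennreal (2 * c) * indicator {a..b} y \<partial>lborel)"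
    using ab c0 by (subst nn_integral_cmult_indicator) (simp_all add: ennreal_mult)
  also have "\<dots> = (\<integral>\<^sup>+y. ennreal (2 * c * indicator {a..b} y) \<partial>lborel)"
    by (intro nn_integral_cong) (auto split: split_indicator)
  also have "\<dots> \<le> (\<integral>\<^sup>+y. ennreal (g y + g (a + b - y)) \<partial>lborel)"
    by (intro nn_integral_mono ennreal_leI pt)
  also have "\<dots> = (\<integral>\<^sup>+y. ennreal (g y) \<partial>lborel) + (\<integral>\<^sup>+y. ennreal (g (a + b - y)) \<partial>lborel)"
    by (simp add: nn nn_integral_add)
  also have "(\<integral>\<^sup>+y. ennreal (g (a + b - y)) \<partial>lborel) = (\<integral>\<^sup>+y. ennreal (g y) \<partial>lborel)"
    by (rule nn_integral_reflect) simp
  finally have "ennreal (2 * c * (b - a)) \<le> ennreal 2"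
    by (simp add: pdf_nn_integral[OF g])
  then have "2 * c * (b - a) \<le> 2" by (subst (asm) ennreal_le_iff) auto
  then show ?thesis by (simp add: c_def mult.commute)
qed

text \<open>Serves to make convolution integrals finite. Any point is far from at least one of two
  fixed points where \<open>g\<close> is positive, and the product bound then caps \<open>g\<close>
  there.\<close>

lemma PF2_pdf_bounded:
  assumes g: "pdf g" and P: "PF2 g"
  obtains B where "\<And>x. g x \<le> B"
proof -
  note nn = pdf_nonneg[OF g]
  obtain a b where ab: "a < b" "0 < g a" "0 < g b" using pdf_two_points[OF g] .
  define c where "c = min (g a) (g b)"
  \<comment> \<open>With half the gap, every \<open>x\<close> has distance at least \<open>d\<close>
    from \<open>a\<close> or from \<open>b\<close>.\<close>
  define d where "d = (b - a) / 2"
  have c: "0 < c" and d: "0 < d" using ab by (auto simp: c_def d_def)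
  have far: "g x \<le> 1 / (d\<^sup>2 * c)" if z: "d \<le> \<bar>x - z\<bar>" "c \<le> g z" for x z
  proof -
    have 1: "\<bar>x - z\<bar> * sqrt (g x * g z) \<le> 1"
      using PF2_pdf_product_bound[OF g P, of x z] PF2_pdf_product_bound[OF g P, of z x]
      by (cases "x \<le> z") (auto simp: mult.commute)
    have "d * sqrt (g x * c) \<le> \<bar>x - z\<bar> * sqrt (g x * g z)"
      using z d c nn by (intro mult_mono) (auto intro: mult_left_mono)
    then have "(d * sqrt (g x * c))\<^sup>2 \<le> 1"
      using 1 d c nn[of x] by (intro power_le_one) auto
    then have "d\<^sup>2 * (g x * c) \<le> 1"
      using c nn[of x] by (simp add: power_mult_distrib)
    then show ?thesis using c d by (simp add: field_simps)
  qed
  have "g x \<le> 1 / (d\<^sup>2 * c)" for x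
  proof (cases "d \<le> \<bar>x - a\<bar>")
    case True then show ?thesis by (rule far) (simp add: c_def)
  next
    case False
    then have "d \<le> \<bar>x - b\<bar>" by (simp add: d_def abs_if field_simps split: if_splits)
    then show ?thesis by (rule far) (simp add: c_def)
  qed
  then show ?thesis by (rule that)
qed

section \<open>Convolution and its compatibility with the likelihood ratio order\<close>

lemma fconv_nonneg: "0 \<le> fconv a b x"
  by (simp add: fconv_def)

lemma fconv_measurable:
  assumes [measurable]: "a \<in> borel_measurable borel" "b \<in> borel_measurable borel"
  shows "fconv a b \<in> borel_measurable borel"
  unfolding fconv_def by measurable

lemma fconv_commute:
  assumes [measurable]: "a \<in> borel_measurable borel" "b \<in> borel_measurable borel"
  shows "fconv a b = fconv b a"
proof
  fix x
  have "(\<integral>\<^sup>+y. ennreal (a (x - y) * b y) \<partial>lborel) = (\<integral>\<^sup>+y. ennreal (b (x - y) * a y) \<partial>lborel)"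
    using nn_integral_reflect[of "\<lambda>y. ennreal (b (x - y) * a y)" x] by (simp add: mult.commute)
  then show "fconv a b x = fconv b a x" by (simp add: fconv_def)
qed

text \<open>The integral is at most \<open>B\<close> because \<open>b\<close> has mass 1, so
  \<open>enn2real\<close> loses nothing.\<close>

lemma ennreal_fconv:
  assumes a: "\<And>x. 0 \<le> a x" and B: "\<And>x. a x \<le> B" and b: "pdf b"
  shows "ennreal (fconv a b x) = (\<integral>\<^sup>+y. ennreal (a (x - y) * b y) \<partial>lborel)"
proof -
  note [measurable] = pdf_measurable[OF b]
  have "(\<integral>\<^sup>+y. ennreal (a (x - y) * b y) \<partial>lborel) \<le> (\<integral>\<^sup>+y. ennreal B * ennreal (b y) \<partial>lborel)"
    using B order_trans[OF a B] pdf_nonneg[OF b]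
    by (intro nn_integral_mono) (simp add: ennreal_mult[symmetric] ennreal_leI mult_right_mono)
  also have "\<dots> = ennreal B"
    by (simp add: nn_integral_cmult pdf_nn_integral[OF b])
  finally have "(\<integral>\<^sup>+y. ennreal (a (x - y) * b y) \<partial>lborel) \<noteq> \<top>"
    by (rule neq_top_trans[OF ennreal_neq_top])
  then show ?thesis by (simp add: fconv_def ennreal_enn2real_if)
qed

lemma pdf_fconv:
  assumes a: "pdf a" and B: "\<And>x. a x \<le> B" and b: "pdf b"
  shows "pdf (fconv a b)"
proof -
  note [measurable] = pdf_measurable[OF b] pdf_measurable[OF a]
  note nn = pdf_nonneg[OF a] pdf_nonneg[OF b]
  have "(\<integral>\<^sup>+x. ennreal (fconv a b x) \<partial>lborel)
      = (\<integral>\<^sup>+x. \<integral>\<^sup>+y. ennreal (a (x - y)) * ennreal (b y) \<partial>lborel \<partial>lborel)"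
    by (simp add: ennreal_fconv[OF nn(1) B b] nn ennreal_mult)
  also have "\<dots> = (\<integral>\<^sup>+y. \<integral>\<^sup>+x. ennreal (a (x - y)) * ennreal (b y) \<partial>lborel \<partial>lborel)"
    by (rule lborel_pair.Fubini'[symmetric]) measurable
  also have "\<dots> = (\<integral>\<^sup>+y. ennreal (b y) \<partial>lborel)"
    by (simp add: nn_integral_multc nn_integral_translate[of "\<lambda>x. ennreal (a x)"] pdf_nn_integral[OF a])
  finally show ?thesis
    by (simp add: pdf_def fconv_nonneg fconv_measurable pdf_nn_integral[OF b])
qed

text \<open>The symmetrised form of the basic composition formula for totally positive kernels.\<close>
lemma nn_integral_composition:
  fixes F1 F2 G1 G2 :: "real \<Rightarrow> real"
  assumes [measurable]: "F1 \<in> borel_measurable borel" "F2 \<in> borel_measurable borel"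
      "G1 \<in> borel_measurable borel" "G2 \<in> borel_measurable borel"
    and nn: "\<And>x. 0 \<le> F1 x" "\<And>x. 0 \<le> F2 x" "\<And>x. 0 \<le> G1 x" "\<And>x. 0 \<le> G2 x"
    and F: "\<And>y z. y \<le> z \<Longrightarrow> F1 z * F2 y \<le> F1 y * F2 z"
    and G: "\<And>y z. y \<le> z \<Longrightarrow> G1 z * G2 y \<le> G1 y * G2 z"
  shows "(\<integral>\<^sup>+y. ennreal (G2 y * F1 y) \<partial>lborel) * (\<integral>\<^sup>+y. ennreal (G1 y * F2 y) \<partial>lborel)
       \<le> (\<integral>\<^sup>+y. ennreal (G1 y * F1 y) \<partial>lborel) * (\<integral>\<^sup>+y. ennreal (G2 y * F2 y) \<partial>lborel)"
proof -
  have prod: "(\<integral>\<^sup>+y. ennreal (p y) \<partial>lborel) * (\<integral>\<^sup>+z. ennreal (q z) \<partial>lborel)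
      = (\<integral>\<^sup>+y. \<integral>\<^sup>+z. ennreal (p y * q z) \<partial>lborel \<partial>lborel)"
    if [measurable]: "p \<in> borel_measurable borel" "q \<in> borel_measurable borel"
      and "\<And>x. 0 \<le> p x" "\<And>x. 0 \<le> q x" for p q :: "real \<Rightarrow> real"
    using that by (simp add: ennreal_mult nn_integral_cmult nn_integral_multc)
  \<comment> \<open>Averaging over the exchange of \<open>y\<close> and \<open>z\<close> turns the
    claim into a pointwise inequality; without symmetrisation the integrands are not
    comparable.\<close>
  have twice: "2 * ((\<integral>\<^sup>+y. ennreal (p y) \<partial>lborel) * (\<integral>\<^sup>+z. ennreal (q z) \<partial>lborel))
      = (\<integral>\<^sup>+y. \<integral>\<^sup>+z. ennreal (p y * q z + p z * q y) \<partial>lborel \<partial>lborel)"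
    if [measurable]: "p \<in> borel_measurable borel" "q \<in> borel_measurable borel"
      and "\<And>x. 0 \<le> p x" "\<And>x. 0 \<le> q x" for p q :: "real \<Rightarrow> real"
  proof -
    have "(\<integral>\<^sup>+y. ennreal (p y) \<partial>lborel) * (\<integral>\<^sup>+z. ennreal (q z) \<partial>lborel)
        = (\<integral>\<^sup>+y. \<integral>\<^sup>+z. ennreal (q y * p z) \<partial>lborel \<partial>lborel)"
      by (subst mult.commute, rule prod) (use that in auto)
    then have "2 * ((\<integral>\<^sup>+y. ennreal (p y) \<partial>lborel) * (\<integral>\<^sup>+z. ennreal (q z) \<partial>lborel))
        = (\<integral>\<^sup>+y. \<integral>\<^sup>+z. ennreal (p y * q z) \<partial>lborel \<partial>lborel)
        + (\<integral>\<^sup>+y. \<integral>\<^sup>+z. ennreal (q y * p z) \<partial>lborel \<partial>lborel)"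
      using prod[OF that] by (simp add: mult_2)
    also have "\<dots> = (\<integral>\<^sup>+y. \<integral>\<^sup>+z. ennreal (p y * q z + p z * q y) \<partial>lborel \<partial>lborel)"
      using that by (simp add: nn_integral_add[symmetric] mult.commute)
    finally show ?thesis .
  qed
  \<comment> \<open>The difference of the two sides is a product of two 2x2 minors, which have the
    same sign whichever of \<open>y\<close> and \<open>z\<close> is larger.\<close>
  have pt: "(G2 y * F1 y) * (G1 z * F2 z) + (G2 z * F1 z) * (G1 y * F2 y)
      \<le> (G1 y * F1 y) * (G2 z * F2 z) + (G1 z * F1 z) * (G2 y * F2 y)" for y z
  proof -
    have "0 \<le> (F1 y * F2 z - F1 z * F2 y) * (G1 y * G2 z - G1 z * G2 y)"
      using F[of y z] G[of y z] F[of z y] G[of z y]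
      by (cases "y \<le> z") (auto intro: mult_nonneg_nonneg mult_nonpos_nonpos)
    then show ?thesis by (simp add: algebra_simps)
  qed
  have "2 * ((\<integral>\<^sup>+y. ennreal (G2 y * F1 y) \<partial>lborel) * (\<integral>\<^sup>+y. ennreal (G1 y * F2 y) \<partial>lborel))
      \<le> 2 * ((\<integral>\<^sup>+y. ennreal (G1 y * F1 y) \<partial>lborel) * (\<integral>\<^sup>+y. ennreal (G2 y * F2 y) \<partial>lborel))"
    by (subst (1 2) twice) (auto simp: nn simp del: ennreal_plus intro!: nn_integral_mono ennreal_leI pt)
  then show ?thesis
    by (subst (asm) ennreal_mult_le_mult_iff) auto
qed

text \<open>The composition formula with \<open>p\<close>, \<open>q\<close> as one pair of functions
  and the kernel rows \<open>g (u - y)\<close>, \<open>g (v - y)\<close> as the other.\<close>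

lemma lr_mono_fconv:
  assumes g: "pdf g" and P: "PF2 g" and p: "pdf p" and q: "pdf q" and pq: "lr_mono p q"
  shows "lr_mono (fconv g p) (fconv g q)"
  unfolding lr_mono_def
proof (intro allI impI)
  fix u v :: real assume uv: "u \<le> v"
  note [measurable] = pdf_measurable[OF g] pdf_measurable[OF p] pdf_measurable[OF q]
  note nn = pdf_nonneg[OF g] pdf_nonneg[OF p] pdf_nonneg[OF q]
  obtain B where B: "\<And>x. g x \<le> B" using PF2_pdf_bounded[OF g P] by blast
  have G: "g (u - z) * g (v - y) \<le> g (u - y) * g (v - z)" if "y \<le> z" for y z
  proof -
    have "g (v - y) * g (u - y - (z - y)) \<le> g (u - y) * g (v - y - (z - y))"
      using P that uv lr_monoD[of g "\<lambda>x. g (x - (z - y))" "u - y" "v - y"] by (auto simp: PF2_def)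
    then show ?thesis by (simp add: mult.commute)
  qed
  have "ennreal (fconv g p v) * ennreal (fconv g q u) \<le> ennreal (fconv g p u) * ennreal (fconv g q v)"
    unfolding ennreal_fconv[OF nn(1) B p] ennreal_fconv[OF nn(1) B q]
    by (rule nn_integral_composition) (auto simp: nn G lr_monoD[OF pq])
  then show "fconv g p v * fconv g q u \<le> fconv g p u * fconv g q v"
    by (simp add: ennreal_mult[symmetric] fconv_nonneg)
qed

lemma pdf_translate:
  assumes a: "pdf a"
  shows "pdf (\<lambda>x. a (x - s))"
proof -
  note [measurable] = pdf_measurable[OF a]
  show ?thesis
    using pdf_nonneg[OF a] pdf_nn_integral[OF a] nn_integral_translate[of "\<lambda>x. ennreal (a x)" s]
    by (simp add: pdf_def)
qed

text \<open>Convolution commutes with translation, so the claim is preservation of the order applied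
  to \<open>a\<close> and its translate.\<close>

lemma PF2_fconv:
  assumes g: "pdf g" "PF2 g" and a: "pdf a" "PF2 a"
  shows "PF2 (fconv g a)"
  unfolding PF2_def
proof (intro allI impI)
  fix s :: real assume s: "0 \<le> s"
  note [measurable] = pdf_measurable[OF g(1)] pdf_measurable[OF a(1)]
  have "fconv g (\<lambda>x. a (x - s)) = fconv (\<lambda>x. a (x - s)) g"
    by (rule fconv_commute) auto
  also have "\<dots> = (\<lambda>x. fconv a g (x - s))"
    by (simp add: fconv_def fun_eq_iff algebra_simps)
  also have "fconv a g = fconv g a"
    by (rule fconv_commute) auto
  finally have eq: "fconv g (\<lambda>x. a (x - s)) = (\<lambda>x. fconv g a (x - s))" .
  have "lr_mono a (\<lambda>x. a (x - s))" using a(2) s by (simp add: PF2_def)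
  from lr_mono_fconv[OF g a(1) pdf_translate[OF a(1)] this]
  show "lr_mono (fconv g a) (\<lambda>x. fconv g a (x - s))" by (simp add: eq)
qed

section \<open>Convolution powers and the law of the sample sum\<close>

text \<open>\<open>conv_pow g k\<close> is the convolution of \<open>k + 1\<close> copies of \<open>g\<close>.\<close>
primrec conv_pow :: "(real \<Rightarrow> real) \<Rightarrow> nat \<Rightarrow> real \<Rightarrow> real" where
  "conv_pow g 0 = g"
| "conv_pow g (Suc k) = fconv g (conv_pow g k)"

lemma pdf_conv_pow:
  assumes g: "pdf g" "PF2 g"
  shows "pdf (conv_pow g k)"
proof (induction k)
  case (Suc k)
  obtain B where B: "\<And>x. g x \<le> B" using PF2_pdf_bounded[OF g] by blast
  show ?case using pdf_fconv[OF g(1) B Suc] by simp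
qed (simp add: g)

lemma PF2_conv_pow:
  assumes g: "pdf g" "PF2 g"
  shows "PF2 (conv_pow g k)"
  by (induction k) (simp_all add: g PF2_fconv pdf_conv_pow)

text \<open>The factors are exchanged in two moves, the inner power first and then the outer factor,
  with \<open>fconv g (conv_pow h k)\<close> in between.\<close>

lemma lr_mono_conv_pow:
  assumes g: "pdf g" "PF2 g" and h: "pdf h" "PF2 h" and gh: "lr_mono g h"
  shows "lr_mono (conv_pow g k) (conv_pow h k)"
proof (induction k)
  case (Suc k)
  let ?g = "conv_pow g k" and ?h = "conv_pow h k"
  note pk = pdf_conv_pow[OF g, of k] pdf_conv_pow[OF h, of k]
  have 1: "lr_mono (fconv g ?g) (fconv g ?h)"
    by (rule lr_mono_fconv[OF g pk Suc])
  \<comment> \<open>Only the second argument of \<open>fconv\<close> can be varied, so the outer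
    factor is exchanged there and commuted back.\<close>
  have "lr_mono (fconv ?h g) (fconv ?h h)"
    by (rule lr_mono_fconv[OF pk(2) PF2_conv_pow[OF h] g(1) h(1) gh])
  then have 2: "lr_mono (fconv g ?h) (fconv h ?h)"
    by (simp add: fconv_commute pdf_measurable pk g h)
  obtain B where B: "\<And>x. g x \<le> B" using PF2_pdf_bounded[OF g] by blast
  \<comment> \<open>The positive value of the middle density that transitivity requires.\<close>
  obtain w where "0 < fconv g ?h w"
    using pdf_two_points[OF pdf_fconv[OF g(1) B pk(2)]] by metis
  from lr_mono_trans[OF 1 2 fconv_nonneg fconv_nonneg fconv_nonneg this]
  show ?case by simp
qed (simp add: gh)

lemma distributed_sum_conv_pow:
  fixes X :: "nat \<Rightarrow> 'a \<Rightarrow> real"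
  assumes "prob_space M" and ind: "prob_space.indep_vars M (\<lambda>_. borel) X {..k}"
    and X: "\<And>i. i \<le> k \<Longrightarrow> distributed M lborel (X i) (\<lambda>x. ennreal (g x))"
    and g: "pdf g" "PF2 g"
  shows "distributed M lborel (\<lambda>\<omega>. \<Sum>i\<le>k. X i \<omega>) (\<lambda>x. ennreal (conv_pow g k x))"
  using ind X
proof (induction k)
  case 0
  then show ?case by simp
next
  case (Suc k)
  interpret prob_space M by fact
  obtain B where B: "\<And>x. g x \<le> B" using PF2_pdf_bounded[OF g] by blast
  have "indep_vars (\<lambda>_. borel) X {..k}"
    using Suc.prems(1) by (rule indep_vars_subset) auto
  with Suc have IH: "distributed M lborel (\<lambda>\<omega>. \<Sum>i\<le>k. X i \<omega>) (\<lambda>x. ennreal (conv_pow g k x))"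
    by simp
  have "indep_var borel (X (Suc k)) borel (\<lambda>\<omega>. \<Sum>i\<le>k. X i \<omega>)"
    using Suc.prems(1) by (intro indep_vars_sum) (auto simp: atMost_Suc)
  from distributed_convolution[OF this Suc.prems(2)[OF order_refl] IH]
  show ?case
    using pdf_nonneg[OF g(1)] pdf_nonneg[OF pdf_conv_pow[OF g]]
    by (simp add: ennreal_fconv[OF pdf_nonneg[OF g(1)] B pdf_conv_pow[OF g]] ennreal_mult add.commute)
qed

lemma distr_sum_sample_law:
  assumes g: "pdf (\<lambda>x. f x \<theta>)" "PF2 (\<lambda>x. f x \<theta>)"
  shows "distr (sample_law f (Suc k) \<theta>) borel (\<lambda>xs. \<Sum>i<Suc k. xs i)
       = density lborel (\<lambda>x. ennreal (conv_pow (\<lambda>x. f x \<theta>) k x))"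
proof -
  note [measurable] = pdf_measurable[OF g(1)]
  define D where "D = density lborel (\<lambda>x. ennreal (f x \<theta>))"
  define M where "M = PiM {..k} (\<lambda>_. D)"
  have setsD [measurable_cong]: "sets D = sets borel" by (simp add: D_def)
  interpret D: prob_space D
    by (rule prob_spaceI) (simp add: D_def emeasure_density pdf_nn_integral[OF g(1)])
  interpret M: prob_space M
    unfolding M_def by (rule prob_space_PiM) (rule D.prob_space_axioms)
  have comp: "distr M D (\<lambda>\<omega>. \<omega> i) = D" if "i \<le> k" for i
    unfolding M_def using that by (intro distr_PiM_component) (auto intro: D.prob_space_axioms)
  have meas: "(\<lambda>\<omega>. \<omega> i) \<in> measurable M borel" if "i \<le> k" for i
    using measurable_component_singleton[of i "{..k}" "\<lambda>_. D"] that
    by (simp add: M_def measurable_cong_sets[OF refl setsD])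
  \<comment> \<open>A push-forward depends on its target only through the sigma-algebra;
    \<open>borel\<close> and \<open>lborel\<close> are both needed below.\<close>
  have comp': "distr M N (\<lambda>\<omega>. \<omega> i) = D" if "i \<le> k" "sets N = sets borel" for i N
    using comp[OF that(1)] that(2) setsD by (metis distr_cong)
  \<comment> \<open>Restricting to \<open>{..k}\<close> is the identity on \<open>M\<close>, so the
    joint law of the coordinates is \<open>M\<close>, the product of their marginals; this is
    independence.\<close>
  have "distr M (PiM {..k} (\<lambda>_. borel)) (\<lambda>\<omega>. \<lambda>i\<in>{..k}. \<omega> i) = distr M M (\<lambda>\<omega>. \<omega>)"
    by (rule distr_cong) (auto simp: M_def space_PiM setsD intro!: sets_PiM_cong)
  also have "\<dots> = M" by simp
  also have "\<dots> = PiM {..k} (\<lambda>i. distr M borel (\<lambda>\<omega>. \<omega> i))"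
    unfolding M_def[symmetric] by (subst M_def, rule PiM_cong) (auto simp: comp')
  finally have ind: "M.indep_vars (\<lambda>_. borel) (\<lambda>i \<omega>. \<omega> i) {..k}"
    using meas by (subst M.indep_vars_iff_distr_eq_PiM') auto
  have "distributed M lborel (\<lambda>\<omega>. \<omega> i) (\<lambda>x. ennreal (f x \<theta>))" if "i \<le> k" for i
    unfolding distributed_def using comp'[OF that, of lborel] meas[OF that] by (simp add: D_def)
  from distributed_sum_conv_pow[OF M.prob_space_axioms ind this g]
  have "distr M lborel (\<lambda>\<omega>. \<Sum>i\<le>k. \<omega> i) = density lborel (\<lambda>x. ennreal (conv_pow (\<lambda>x. f x \<theta>) k x))"
    by (auto simp: distributed_def)
  moreover have "distr M lborel (\<lambda>\<omega>. \<Sum>i\<le>k. \<omega> i) = distr M borel (\<lambda>\<omega>. \<Sum>i\<le>k. \<omega> i)"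
    by (rule distr_cong) auto
  ultimately show ?thesis
    by (simp add: sample_law_def M_def D_def lessThan_Suc_atMost)
qed

section \<open>Transport of the likelihood ratio order along a monotone map\<close>

text \<open>The densities of the images are \<open>p / (p + q)\<close> and \<open>q / (p + q)\<close> composed with the monotone
  left inverse \<open>\<psi>\<close>, relative to the image of the dominating measure \<open>(p + q) \<mu>\<close>.\<close>
lemma lr_le_distr:
  fixes \<phi> \<psi> :: "real \<Rightarrow> real"
  assumes lr: "lr_le P Q" and fin: "finite_measure P" "finite_measure Q"
    and phi: "\<phi> \<in> borel_measurable borel"
    and I: "is_interval I" and psi: "mono_on I \<psi>"
    and inv: "AE x in P. \<phi> x \<in> I \<and> \<psi> (\<phi> x) = x" "AE x in Q. \<phi> x \<in> I \<and> \<psi> (\<phi> x) = x"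
  shows "lr_le (distr P borel \<phi>) (distr Q borel \<phi>)"
proof -
  from lr obtain \<mu> p q where mu: "sets \<mu> = sets borel"
    and [measurable]: "p \<in> borel_measurable borel" "q \<in> borel_measurable borel"
    and nn: "\<And>x. 0 \<le> p x" "\<And>x. 0 \<le> q x"
    and P: "P = density \<mu> (\<lambda>x. ennreal (p x))" and Q: "Q = density \<mu> (\<lambda>x. ennreal (q x))"
    and mono: "\<And>u v. u \<le> v \<Longrightarrow> p v * q u \<le> p u * q v"
    unfolding lr_le_def by blast
  note [measurable_cong] = mu
  note [measurable] = phi
  have [measurable]: "I \<in> sets borel" by (rule real_interval_borel_measurable[OF I])
  define R where "R = density \<mu> (\<lambda>x. ennreal (p x + q x))"
  have setsR [measurable_cong]: "sets R = sets borel" by (simp add: R_def mu)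
  \<comment> \<open>An image of a sigma-finite measure need not be sigma-finite; finiteness of
    \<open>P\<close> and \<open>Q\<close> makes \<open>R\<close>, and hence its image,
    finite.\<close>
  have "emeasure R (space R) = emeasure P (space P) + emeasure Q (space Q)"
    by (simp add: R_def P Q emeasure_density nn nn_integral_add)
  also have "\<dots> \<noteq> \<infinity>"
    using finite_measure.emeasure_finite[OF fin(1)] finite_measure.emeasure_finite[OF fin(2)] by simp
  finally have "finite_measure R" by (intro finite_measureI)
  then have "finite_measure (distr R borel \<phi>)"
    by (rule finite_measure.finite_measure_distr) measurable
  then have sf: "sigma_finite_measure (distr R borel \<phi>)"
    by (simp add: finite_measure_def)
  \<comment> \<open>Points where \<open>p\<close> and \<open>q\<close> both vanish carry no mass of
    \<open>P\<close> or \<open>Q\<close>, so nothing is known about \<open>\<phi>\<close> there;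
    they carry no mass of \<open>R\<close> either.\<close>
  have ae: "AE x in \<mu>. 0 < p x + q x \<longrightarrow> \<phi> x \<in> I \<and> \<psi> (\<phi> x) = x"
  proof -
    have "AE x in \<mu>. 0 < ennreal (p x) \<longrightarrow> \<phi> x \<in> I \<and> \<psi> (\<phi> x) = x"
      by (rule AE_density[THEN iffD1, OF _ inv(1)[unfolded P]]) measurable
    moreover have "AE x in \<mu>. 0 < ennreal (q x) \<longrightarrow> \<phi> x \<in> I \<and> \<psi> (\<phi> x) = x"
      by (rule AE_density[THEN iffD1, OF _ inv(2)[unfolded Q]]) measurable
    ultimately show ?thesis
    proof eventually_elim
      case (elim x)
      have "0 < p x \<or> 0 < q x" if "0 < p x + q x" using that by linarith
      with elim show ?case by (simp only: ennreal_less_zero_iff) blast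
    qed
  qed
  \<comment> \<open>The value 0 outside \<open>I\<close> makes both sides of the order inequality
    vanish there; inside \<open>I\<close> they share the same denominator.\<close>
  define lift where "lift = (\<lambda>h t. if t \<in> I then h (\<psi> t) / (p (\<psi> t) + q (\<psi> t)) else (0::real))"
  have psi_meas [measurable]: "\<psi> \<in> borel_measurable (restrict_space borel I)"
    by (rule borel_measurable_mono_on_fnc[OF psi])
  have lift_meas: "lift h \<in> borel_measurable borel" if [measurable]: "h \<in> borel_measurable borel" for h
    unfolding lift_def
    by (subst measurable_If_restrict_space_iff) auto
  have lift_nn: "0 \<le> lift p t" "0 \<le> lift q t" for t
    by (auto simp: lift_def nn)
  have lift_density: "distr (density \<mu> (\<lambda>x. ennreal (h x))) borel \<phi>
      = density (distr R borel \<phi>) (\<lambda>t. ennreal (lift h t))"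
    if h [measurable]: "h \<in> borel_measurable borel" and h0: "\<And>x. 0 \<le> h x"
      and hs: "\<And>x. p x + q x = 0 \<Longrightarrow> h x = 0" for h
  proof -
    note [measurable] = lift_meas[OF h]
    have "density (distr R borel \<phi>) (\<lambda>t. ennreal (lift h t))
        = distr (density R (\<lambda>x. ennreal (lift h (\<phi> x)))) borel \<phi>"
      by (rule density_distr) measurable
    also have "density R (\<lambda>x. ennreal (lift h (\<phi> x)))
        = density \<mu> (\<lambda>x. ennreal (p x + q x) * ennreal (lift h (\<phi> x)))"
      unfolding R_def by (rule density_density_eq) measurable
    also have "\<dots> = density \<mu> (\<lambda>x. ennreal (h x))"
    proof (rule density_cong)
      show "AE x in \<mu>. ennreal (p x + q x) * ennreal (lift h (\<phi> x)) = ennreal (h x)"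
        using ae
      proof eventually_elim
        case (elim x)
        show ?case
        proof (cases "p x + q x = 0")
          case False
          then have "0 < p x + q x" using nn[of x] by simp
          with elim h0[of x] show ?thesis
            by (simp add: lift_def ennreal_mult[symmetric] del: ennreal_plus)
        qed (simp add: hs)
      qed
    qed measurable
    finally show ?thesis by simp
  qed
  have lift_mono: "lift p v * lift q u \<le> lift p u * lift q v" if "u \<le> v" for u v
  proof (cases "u \<in> I \<and> v \<in> I")
    case True
    then have "\<psi> u \<le> \<psi> v" using psi that by (auto simp: mono_on_def)
    from mono[OF this] True show ?thesis
      by (simp add: lift_def nn divide_right_mono mult.commute[of "p (\<psi> v) + q (\<psi> v)"])
  qed (auto simp: lift_def)
  show ?thesis
    unfolding lr_le_def
  proof (intro exI conjI allI impI)
    show "distr P borel \<phi> = density (distr R borel \<phi>) (\<lambda>x. ennreal (lift p x))"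
      unfolding P by (rule lift_density) (use nn in \<open>auto simp: add_nonneg_eq_0_iff\<close>)
    show "distr Q borel \<phi> = density (distr R borel \<phi>) (\<lambda>x. ennreal (lift q x))"
      unfolding Q by (rule lift_density) (use nn in \<open>auto simp: add_nonneg_eq_0_iff\<close>)
  qed (use sf lift_nn lift_mono lift_meas in auto)
qed

text \<open>Since \<open>Y\<close> is an arbitrary set, a Borel set of points on which \<open>h\<close> is inverted is obtained
  from a monotone extension of its inverse, defined on the interval hull of \<open>h ` Y\<close>.\<close>
lemma monotone_left_inverse:
  fixes h :: "real \<Rightarrow> real"
  assumes mono: "mono_on Y h" and inj: "inj_on h Y"
  obtains I \<psi> where "is_interval I" "mono_on I \<psi>" "\<And>y. y \<in> Y \<Longrightarrow> h y \<in> I \<and> \<psi> (h y) = y"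
proof -
  \<comment> \<open>The two bounds make the set under \<open>Sup\<close> nonempty and bounded
    above.\<close>
  define I where "I = {t. (\<exists>y\<in>Y. h y \<le> t) \<and> (\<exists>y\<in>Y. t \<le> h y)}"
  define \<psi> where "\<psi> t = Sup {y\<in>Y. h y \<le> t}" for t
  \<comment> \<open>Injectivity makes the monotone \<open>h\<close> reflect the order, so
    \<open>y\<close> is the maximum of the set defining \<open>\<psi> (h y)\<close>.\<close>
  have le: "y \<le> z" if "y \<in> Y" "z \<in> Y" "h y \<le> h z" for y z
  proof (rule ccontr)
    assume "\<not> y \<le> z"
    then have "h z \<le> h y" using mono that by (auto simp: mono_on_def)
    then show False using that inj \<open>\<not> y \<le> z\<close> by (auto simp: inj_on_def)
  qed
  have bdd: "bdd_above {y\<in>Y. h y \<le> t}" if "t \<in> I" for t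
  proof -
    from that obtain z where z: "z \<in> Y" "t \<le> h z" by (auto simp: I_def)
    show ?thesis by (rule bdd_aboveI[of _ z]) (use z le in fastforce)
  qed
  show ?thesis
  proof
    show "is_interval I"
      unfolding is_interval_1 I_def by (blast intro: order_trans)
    show "mono_on I \<psi>"
    proof (rule mono_onI)
      fix r s assume rs: "r \<in> I" "s \<in> I" "r \<le> s"
      show "\<psi> r \<le> \<psi> s"
        unfolding \<psi>_def
        by (rule cSup_subset_mono) (use rs bdd in \<open>auto simp: I_def\<close>)
    qed
    show "h y \<in> I \<and> \<psi> (h y) = y" if "y \<in> Y" for y
    proof
      show "h y \<in> I" using that by (auto simp: I_def)
      show "\<psi> (h y) = y"
        unfolding \<psi>_def by (rule cSup_eq_maximum) (use that le in auto)
    qed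
  qed
qed

section \<open>The moment estimator as a function of the sample sum\<close>

theorem theorem1:
  fixes f :: "real \<Rightarrow> real \<Rightarrow> real" and \<Theta> :: "real set"
    and m minv :: "real \<Rightarrow> real" and n :: nat and \<theta>1 \<theta>2 :: real
  assumes dens: "\<And>\<theta>. \<theta> \<in> \<Theta> \<Longrightarrow> (\<forall>x. 0 \<le> f x \<theta>) \<and> (\<lambda>x. f x \<theta>) \<in> borel_measurable borel \<and>
                  integrable lborel (\<lambda>x. f x \<theta>) \<and> (LINT x|lborel. f x \<theta>) = 1"
    and mean: "\<And>\<theta>. \<theta> \<in> \<Theta> \<Longrightarrow> integrable lborel (\<lambda>x. x * f x \<theta>) \<and>
                  m \<theta> = (LINT x|lborel. x * f x \<theta>)"
    and cont: "continuous_on \<Theta> m"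
    and tp2: "TP2_on UNIV \<Theta> f"
    and lc: "\<And>\<theta>. \<theta> \<in> \<Theta> \<Longrightarrow> logconcave (\<lambda>x. f x \<theta>)"
    and n: "n \<ge> 1"
    and sample_in_range: "\<And>\<theta>. \<theta> \<in> \<Theta> \<Longrightarrow>
                  AE xs in sample_law f n \<theta>. sample_mean n xs \<in> m ` \<Theta>"
    and minv_meas: "minv \<in> borel_measurable borel"
    and minv_inv: "\<And>y. y \<in> m ` \<Theta> \<Longrightarrow> minv y \<in> \<Theta> \<and> m (minv y) = y"
    and minv_mono: "mono_on (m ` \<Theta>) minv"
    and th: "\<theta>1 \<in> \<Theta>" "\<theta>2 \<in> \<Theta>" "\<theta>1 < \<theta>2"
  shows "lr_le (distr (sample_law f n \<theta>1) borel (\<lambda>xs. minv (sample_mean n xs)))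
               (distr (sample_law f n \<theta>2) borel (\<lambda>xs. minv (sample_mean n xs)))"
proof -
  obtain k where k: "n = Suc k" using n by (cases n) auto
  have pdf: "pdf (\<lambda>x. f x \<theta>)" if "\<theta> \<in> \<Theta>" for \<theta>
    using dens[OF that] by (auto simp: pdf_def nn_integral_eq_integral)
  have pf: "PF2 (\<lambda>x. f x \<theta>)" if "\<theta> \<in> \<Theta>" for \<theta>
    by (rule logconcave_imp_PF2[OF lc[OF that]])
  note g1 = pdf[OF th(1)] pf[OF th(1)] and g2 = pdf[OF th(2)] pf[OF th(2)]
  \<comment> \<open>\<open>TP2_on\<close> speaks of distinct points only; for \<open>u = v\<close>
    the two sides agree.\<close>
  have "f v \<theta>1 * f u \<theta>2 \<le> f u \<theta>1 * f v \<theta>2" if "u \<le> v" for u v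
    using tp2 that th by (cases "u = v") (auto simp: TP2_on_def mult.commute)
  then have "lr_mono (\<lambda>x. f x \<theta>1) (\<lambda>x. f x \<theta>2)" by (simp add: lr_mono_def)
  from lr_mono_conv_pow[OF g1 g2 this]
  have lr: "lr_mono (conv_pow (\<lambda>x. f x \<theta>1) k) (conv_pow (\<lambda>x. f x \<theta>2) k)" .

  define S where "S \<theta> = distr (sample_law f n \<theta>) borel (\<lambda>xs. \<Sum>i<n. xs i)" for \<theta>
  have S: "S \<theta> = density lborel (\<lambda>x. ennreal (conv_pow (\<lambda>x. f x \<theta>) k x))" if "\<theta> \<in> \<Theta>" for \<theta>
    unfolding S_def k by (rule distr_sum_sample_law[of f _ k, OF pdf[OF that] pf[OF that]])
  have pk: "pdf (conv_pow (\<lambda>x. f x \<theta>) k)" if "\<theta> \<in> \<Theta>" for \<theta>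
    by (rule pdf_conv_pow[OF pdf[OF that] pf[OF that]])
  have lrS: "lr_le (S \<theta>1) (S \<theta>2)"
    unfolding lr_le_def
    by (intro exI[of _ lborel] exI[of _ "conv_pow (\<lambda>x. f x \<theta>1) k"] exI[of _ "conv_pow (\<lambda>x. f x \<theta>2) k"])
      (use pk[OF th(1)] pk[OF th(2)] lr th S sigma_finite_lborel in \<open>auto simp: pdf_def lr_mono_def\<close>)
  have finS: "finite_measure (S \<theta>)" if "\<theta> \<in> \<Theta>" for \<theta>
    using pk[OF that] by (intro finite_measureI) (simp add: S[OF that] emeasure_density pdf_def)

  have "inj_on minv (m ` \<Theta>)" using minv_inv by (metis inj_onI)
  from monotone_left_inverse[OF minv_mono this]
  obtain I \<psi> where I: "is_interval I" and psi: "mono_on I \<psi>"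
    and inv: "\<And>y. y \<in> m ` \<Theta> \<Longrightarrow> minv y \<in> I \<and> \<psi> (minv y) = y" by blast
  \<comment> \<open>The division by \<open>n\<close> is absorbed into \<open>\<phi>\<close>, and its
    left inverse accordingly carries the factor \<open>real n\<close>.\<close>
  define \<phi> where "\<phi> s = minv (s / real n)" for s
  have phi [measurable]: "\<phi> \<in> borel_measurable borel"
    unfolding \<phi>_def using minv_meas by measurable
  have psi': "mono_on I (\<lambda>t. real n * \<psi> t)"
    using psi by (auto simp: mono_on_def intro: mult_left_mono)
  have [measurable]: "I \<in> sets borel" by (rule real_interval_borel_measurable[OF I])
  have [measurable]: "\<psi> \<in> borel_measurable (restrict_space borel I)"
    by (rule borel_measurable_mono_on_fnc[OF psi])
  have sum_meas: "(\<lambda>xs. \<Sum>i<n. xs i) \<in> borel_measurable (sample_law f n \<theta>)" for \<theta>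
    unfolding sample_law_def by measurable
  have aeS: "AE s in S \<theta>. \<phi> s \<in> I \<and> real n * \<psi> (\<phi> s) = s" if "\<theta> \<in> \<Theta>" for \<theta>
  proof -
    \<comment> \<open>Moving the almost sure statement through \<open>distr\<close> needs a Borel
      set, while \<open>\<psi>\<close> is known to be measurable only on \<open>I\<close>; hence the
      extension by 0.\<close>
    have ext: "(\<lambda>t. if t \<in> I then \<psi> t else 0) \<in> borel_measurable borel"
      by (subst measurable_If_restrict_space_iff) auto
    have "{s. \<phi> s \<in> I \<and> real n * \<psi> (\<phi> s) = s}
        = {s\<in>space borel. \<phi> s \<in> I \<and> real n * (if \<phi> s \<in> I then \<psi> (\<phi> s) else 0) = s}" by auto
    also have "\<dots> \<in> sets borel"
      using measurable_compose[OF phi ext] by measurable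
    finally have meas: "{s \<in> space borel. \<phi> s \<in> I \<and> real n * \<psi> (\<phi> s) = s} \<in> sets borel" by simp
    show ?thesis
      unfolding S_def AE_distr_iff[OF sum_meas meas]
      using sample_in_range[OF that]
    proof eventually_elim
      case (elim xs)
      from inv[OF this] n show ?case by (simp add: \<phi>_def sample_mean_def)
    qed
  qed
  have "distr (S \<theta>) borel \<phi> = distr (sample_law f n \<theta>) borel (\<lambda>xs. minv (sample_mean n xs))" for \<theta>
    unfolding S_def using sum_meas phi
    by (subst distr_distr) (auto simp: o_def \<phi>_def sample_mean_def)
  with lr_le_distr[OF lrS finS[OF th(1)] finS[OF th(2)] phi I psi' aeS[OF th(1)] aeS[OF th(2)]]
  show ?thesis by simp
qed

end
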